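(* Let $N\geqslant 1$ and $m \geqslant 1$ be integers, let $\text{SNR}_1 \leqslant \text{SNR}_2 \leqslant \dots \leqslant \text{SNR}_m$ be real numbers, and let $n_1,\dots,n_m$ be nonnegative integers with $\sum_{i=1}^m n_i = 2N$. Consider a set of $2N$ receivers in which, for each $i$, exactly $n_i$ receivers have SNR value $\text{SNR}_i$. Consider the following iterative procedure: among the receivers not yet grouped, pick two receivers whose SNR difference (in absolute value) is the largest possible, group them as a pair, remove them from the set of ungrouped receivers, and repeat until all receivers are grouped. Then the grouping produced by this procedure attains the maximum, over all groupings of the $2N$ receivers into $N$ disjoint pairs, of the average SNR difference $\Delta$.
   Context: A grouping is a partition of the $2N$ receivers into $N$ disjoint pairs. For indices $i,j \in \{1,\dots,m\}$ put $\Delta_{i,j} = |\text{SNR}_i - \text{SNR}_j|$. If the $k$-th pair of a grouping ($1\leqslant k \leqslant N$) consists of a receiver with SNR value $\text{SNR}_{i_k}$ and a receiver with SNR value $\text{SNR}_{j_k}$, the average SNR difference of the grouping is $$\Delta = \frac{1}{N}\sum_{k=1}^{N} \Delta_{i_k,j_k}.$$ If at some step of the procedure several pairs of ungrouped receivers have the largest SNR difference, any one of them may be picked. *)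

theory Defs
  imports Complex_Main "HOL-Library.Disjoint_Sets"
begin

definition grouping :: "'r set \<Rightarrow> nat \<Rightarrow> 'r set set \<Rightarrow> bool" where
  "grouping R N G \<longleftrightarrow> partition_on R G \<and> card G = N \<and> (\<forall>p\<in>G. card p = 2)"

definition snr_diff :: "(nat \<Rightarrow> real) \<Rightarrow> nat \<Rightarrow> nat \<Rightarrow> real" where
  "snr_diff SNR i j = \<bar>SNR i - SNR j\<bar>"

text \<open>
  A receiver \<open>r\<close> has SNR value \<open>SNR (idx r)\<close>. Pairs are unordered, so the difference of a pair
  is read off from any enumeration of its two elements; lemma \<open>pair_diff_doubleton\<close>
  shows that the description is well defined.
\<close>

definition pair_diff :: "(nat \<Rightarrow> real) \<Rightarrow> ('r \<Rightarrow> nat) \<Rightarrow> 'r set \<Rightarrow> real" where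
  "pair_diff SNR idx p = (THE d. \<exists>a b. p = {a, b} \<and> d = snr_diff SNR (idx a) (idx b))"

lemma pair_diff_doubleton: "pair_diff SNR idx {a, b} = snr_diff SNR (idx a) (idx b)"
  unfolding pair_diff_def
  by (rule the_equality) (auto simp: doubleton_eq_iff snr_diff_def)

definition avg_diff :: "(nat \<Rightarrow> real) \<Rightarrow> ('r \<Rightarrow> nat) \<Rightarrow> nat \<Rightarrow> 'r set set \<Rightarrow> real" where
  "avg_diff SNR idx N G = 1 / real N * (\<Sum>p\<in>G. pair_diff SNR idx p)"

text \<open>
  A state \<open>(U, G)\<close> consists of the ungrouped receivers \<open>U\<close> and the pairs \<open>G\<close> formed so far.
  The step is a relation because ties may be broken arbitrarily.
\<close>

inductive greedy_step ::
  "(nat \<Rightarrow> real) \<Rightarrow> ('r \<Rightarrow> nat) \<Rightarrow> 'r set \<times> 'r set set \<Rightarrow> 'r set \<times> 'r set set \<Rightarrow> bool"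
  for SNR :: "nat \<Rightarrow> real" and idx :: "'r \<Rightarrow> nat"
where
  pick: "\<lbrakk>a \<in> U; b \<in> U; a \<noteq> b;
     \<And>c d. \<lbrakk>c \<in> U; d \<in> U; c \<noteq> d\<rbrakk>
       \<Longrightarrow> snr_diff SNR (idx c) (idx d) \<le> snr_diff SNR (idx a) (idx b)\<rbrakk>
   \<Longrightarrow> greedy_step SNR idx (U, G) (U - {a, b}, insert {a, b} G)"

definition greedy_output :: "(nat \<Rightarrow> real) \<Rightarrow> ('r \<Rightarrow> nat) \<Rightarrow> 'r set \<Rightarrow> 'r set set \<Rightarrow> bool" where
  "greedy_output SNR idx R G \<longleftrightarrow> (greedy_step SNR idx)\<^sup>*\<^sup>* (R, {}) ({}, G)"

end

theory Submission
  imports Defs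
begin

text \<open>
  An exchange argument, by induction on the number of ungrouped receivers. Let \<open>{a, b}\<close> be a pair
  with the largest SNR difference. If a grouping contains instead \<open>{a, c}\<close> and \<open>{b, d}\<close>, then
  replacing these by \<open>{a, b}\<close> and \<open>{c, d}\<close> does not decrease the total difference, because the SNR
  values of \<open>c\<close> and \<open>d\<close> lie between those of \<open>a\<close> and \<open>b\<close>. Hence some best grouping contains
  \<open>{a, b}\<close>, and the rest of it is a best grouping of the remaining receivers.
\<close>

lemma grouping_finite:
  assumes "finite U" and "grouping U k P"
  shows "finite P"
  using assms finite_elements unfolding grouping_def by blast

lemma grouping_remove_pair:
  assumes "finite U" and "grouping U (Suc k) H" and "p \<in> H"
  shows "grouping (U - p) k (H - {p})"
proof -
  have H: "\<Union>H = U" "disjoint H" "{} \<notin> H" "card H = Suc k" "\<forall>q\<in>H. card q = 2"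
    using assms(2) unfolding grouping_def partition_on_def by auto
  have "\<Union>(H - {p}) = U - p"
    using H(1,2) assms(3) unfolding disjoint_def by fastforce
  moreover have "disjoint (H - {p})"
    using H(2) by (rule pairwise_subset) auto
  ultimately show ?thesis
    using H assms(3) grouping_finite[OF assms(1,2)]
    unfolding grouping_def partition_on_def by auto
qed

text \<open>Guarantees that adding a removed pair to a grouping of the rest raises the cardinality
  by one and that the sum of differences splits accordingly.\<close>

lemma not_in_grouping_diff:
  assumes "grouping (U - p) k P" and "p \<noteq> {}"
  shows "p \<notin> P"
  using assms unfolding grouping_def partition_on_def by auto

lemma grouping_add_pair:
  assumes "finite U" and "grouping (U - {a, b}) k P" and "a \<in> U" "b \<in> U" "a \<noteq> b"
  shows "grouping U (Suc k) (insert {a, b} P)"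
proof -
  have P: "\<Union>P = U - {a, b}" "disjoint P" "{} \<notin> P" "card P = k" "\<forall>q\<in>P. card q = 2"
    using assms(2) unfolding grouping_def partition_on_def by auto
  have "disjoint (insert {a, b} P)"
    using P(1,2) unfolding disjoint_def by blast
  then show ?thesis
    using P assms(3-5) grouping_finite[OF _ assms(2)] not_in_grouping_diff[OF assms(2)] assms(1)
    unfolding grouping_def partition_on_def by auto
qed

lemma grouping_partner:
  assumes "grouping U k H" and "a \<in> U"
  obtains c where "{a, c} \<in> H" "c \<noteq> a" "c \<in> U"
proof -
  obtain p where p: "p \<in> H" "a \<in> p"
    using assms unfolding grouping_def partition_on_def by blast
  moreover have "card p = 2" "p \<subseteq> U"
    using p assms(1) unfolding grouping_def partition_on_def by auto
  ultimately obtain c where "p = {a, c}" "c \<noteq> a"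
    by (auto simp: card_2_iff insert_commute)
  then show ?thesis
    using that p(1) \<open>p \<subseteq> U\<close> by blast
qed

text \<open>The bound is phrased through a grouping \<open>H'\<close> of \<open>U - {a, b}\<close>,
  so that optimality on the remaining receivers can be applied to \<open>H'\<close>
  directly.\<close>

lemma grouping_exchange:
  assumes "finite U" and H: "grouping U (Suc k) H"
    and ab: "a \<in> U" "b \<in> U" "a \<noteq> b"
    and max: "\<And>c d. \<lbrakk>c \<in> U; d \<in> U; c \<noteq> d\<rbrakk>
       \<Longrightarrow> snr_diff SNR (idx c) (idx d) \<le> snr_diff SNR (idx a) (idx b)"
  obtains H' where "grouping (U - {a, b}) k H'"
    and "sum (pair_diff SNR idx) H \<le> snr_diff SNR (idx a) (idx b) + sum (pair_diff SNR idx) H'"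
proof (cases "{a, b} \<in> H")
  case True
  have "sum (pair_diff SNR idx) H = pair_diff SNR idx {a, b} + sum (pair_diff SNR idx) (H - {{a, b}})"
    using grouping_finite[OF assms(1) H] True by (rule sum.remove)
  then show ?thesis
    using that[OF grouping_remove_pair[OF assms(1) H True]] by (simp add: pair_diff_doubleton)
next
  case False
  let ?f = "pair_diff SNR idx"
  obtain c where c: "{a, c} \<in> H" "c \<noteq> a" "c \<in> U"
    using grouping_partner[OF H ab(1)] .
  obtain d where d: "{b, d} \<in> H" "d \<noteq> b" "d \<in> U"
    using grouping_partner[OF H ab(2)] .
  have ne: "c \<noteq> b" "d \<noteq> a"
    using c d False by (auto simp: insert_commute)
  have "{a, c} \<noteq> {b, d}"
    using ab(3) ne by auto
  \<comment> \<open>Distinct blocks of a partition are disjoint. This yields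
    \<open>c \<noteq> d\<close>, without which \<open>{c, d}\<close> would not be a pair.\<close>
  then have "{a, c} \<inter> {b, d} = {}"
    using H c(1) d(1) disjointD[of H "{a, c}" "{b, d}"]
    unfolding grouping_def partition_on_def by simp
  then have cd: "c \<noteq> d"
    by auto
  have finH: "finite H"
    using grouping_finite[OF assms(1) H] .
  have d': "{b, d} \<in> H - {{a, c}}"
    using d(1) \<open>{a, c} \<noteq> {b, d}\<close> by auto
  have g1: "grouping (U - {a, c}) k (H - {{a, c}})"
    using grouping_remove_pair[OF assms(1) H c(1)] .
  have "card (H - {{a, c}}) = k"
    using g1 unfolding grouping_def by blast
  \<comment> \<open>The block \<open>{b, d}\<close> survives the removal of \<open>{a, c}\<close>,
    so \<open>k\<close> is positive and a second pair can be removed.\<close>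
  then obtain j where j: "k = Suc j"
    using d' finH by (cases k) auto
  let ?K = "H - {{a, c}} - {{b, d}}"
  have "grouping (U - {a, c} - {b, d}) j ?K"
    using grouping_remove_pair[OF _ g1[unfolded j] d'] assms(1) by simp
  moreover have "U - {a, c} - {b, d} = U - {a, b} - {c, d}"
    by auto
  ultimately have K: "grouping (U - {a, b} - {c, d}) j ?K"
    by simp
  then have "grouping (U - {a, b}) k (insert {c, d} ?K)"
    unfolding j using grouping_add_pair[OF _ K] assms(1) c d ne cd by auto
  moreover have "sum ?f H = ?f {a, c} + (?f {b, d} + sum ?f ?K)"
    using sum.remove[OF finH c(1), of ?f] sum.remove[OF _ d', of ?f] finH by simp
  moreover have "sum ?f (insert {c, d} ?K) = ?f {c, d} + sum ?f ?K"
    using not_in_grouping_diff[OF K] finH by (intro sum.insert) auto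
  \<comment> \<open>Neither \<open>c\<close> nor \<open>d\<close> is farther from \<open>a\<close>
    or from \<open>b\<close> than these are from each other, so both SNR values lie between those of
    \<open>a\<close> and \<open>b\<close>. If, say, \<open>SNR (idx a) \<le> SNR (idx b)\<close>,
    the left side is the difference of \<open>a\<close> and \<open>b\<close> plus the signed number
    \<open>SNR (idx c) - SNR (idx d)\<close>.\<close>
  moreover have "?f {a, c} + ?f {b, d} \<le> ?f {a, b} + ?f {c, d}"
    using max[OF ab(1) c(3) c(2)[symmetric]] max[OF ab(1) d(3) ne(2)[symmetric]]
      max[OF c(3) ab(2) ne(1)] max[OF d(3) ab(2) d(2)]
    unfolding pair_diff_doubleton snr_diff_def by linarith
  ultimately show ?thesis
    using that by (simp add: pair_diff_doubleton)
qed

text \<open>The pairs \<open>G\<close> formed earlier are arbitrary, which lets the induction start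
  at any state of a run; only the pairs \<open>P\<close> still to be formed are compared with
  groupings of \<open>U\<close>.\<close>

lemma greedy_steps_optimal:
  assumes "(greedy_step SNR idx)\<^sup>*\<^sup>* (U, G) ({}, G')" and "finite U" and "card U = 2 * k"
  shows "\<exists>P. G' = G \<union> P \<and> grouping U k P \<and>
    (\<forall>H. grouping U k H \<longrightarrow> sum (pair_diff SNR idx) H \<le> sum (pair_diff SNR idx) P)"
  using assms
proof (induction "(U, G)" arbitrary: U G k rule: converse_rtranclp_induct)
  case base
  \<comment> \<open>Here \<open>U\<close> is empty, so the cardinality assumption forces
    \<open>k = 0\<close>.\<close>
  then have "grouping {} k H \<longleftrightarrow> H = {}" for H :: "'a set set"
    unfolding grouping_def by (auto simp: partition_on_empty)
  then show ?case
    by (intro exI[of _ "{}"]) simp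
next
  case (step s)
  let ?f = "pair_diff SNR idx"
  from step.hyps(1) show ?case
  proof cases
    case (pick a b)
    have "card {a, b} \<le> card U"
      using pick step.prems by (intro card_mono) auto
    then obtain j where j: "k = Suc j"
      using pick(4) step.prems(2) by (cases k) auto
    have "card (U - {a, b}) = 2 * j"
      using pick step.prems j by (simp add: card_Diff_subset)
    then obtain P where P: "G' = insert {a, b} G \<union> P" "grouping (U - {a, b}) j P"
      and opt: "\<And>H. grouping (U - {a, b}) j H \<Longrightarrow> sum ?f H \<le> sum ?f P"
      using step.hyps(3)[OF pick(1)] step.prems(1) by blast
    have "finite P"
      using grouping_finite[OF _ P(2)] step.prems(1) by simp
    then have sum_insert: "sum ?f (insert {a, b} P) = snr_diff SNR (idx a) (idx b) + sum ?f P"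
      using not_in_grouping_diff[OF P(2)] by (simp add: pair_diff_doubleton)
    have "sum ?f H \<le> sum ?f (insert {a, b} P)" if H: "grouping U k H" for H
    proof -
      obtain H' where "grouping (U - {a, b}) j H'"
        and "sum ?f H \<le> snr_diff SNR (idx a) (idx b) + sum ?f H'"
        using grouping_exchange[OF step.prems(1) H[unfolded j] pick(2-5)] .
      then show ?thesis
        using opt[of H'] sum_insert by linarith
    qed
    moreover have "grouping U k (insert {a, b} P)"
      unfolding j using grouping_add_pair[OF step.prems(1) P(2) pick(2-4)] .
    ultimately show ?thesis
      using P(1) by (intro exI[of _ "insert {a, b} P"]) auto
  qed
qed

lemma greedy_step_exists:
  assumes "finite U" and "x \<in> U" "y \<in> U" "x \<noteq> y"
  obtains a b where "a \<in> U" "b \<in> U" "a \<noteq> b"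
    and "greedy_step SNR idx (U, G) (U - {a, b}, insert {a, b} G)"
proof -
  let ?S = "{(c, d) \<in> U \<times> U. c \<noteq> d}"
  let ?g = "\<lambda>(c, d). snr_diff SNR (idx c) (idx d)"
  have "finite ?S"
    using assms(1) by (intro finite_subset[of ?S "U \<times> U"]) auto
  then have S: "finite (?g ` ?S)" "?g ` ?S \<noteq> {}"
    using assms(2-4) by auto
  \<comment> \<open>The maximum is attained because the set of differences is finite and contains
    that of \<open>x\<close> and \<open>y\<close>.\<close>
  obtain a b where ab: "(a, b) \<in> ?S" "Max (?g ` ?S) = ?g (a, b)"
    using Max_in[OF S] by auto
  have "snr_diff SNR (idx c) (idx d) \<le> snr_diff SNR (idx a) (idx b)"
    if "c \<in> U" "d \<in> U" "c \<noteq> d" for c d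
    using Max_ge[OF S(1), of "?g (c, d)"] ab(2) that by force
  then show ?thesis
    using that[of a b] ab(1) greedy_step.pick[of a U b SNR idx G] by simp
qed

text \<open>Keeps the optimality claim from being vacuous. Each step removes two receivers, so an
  even number of them never leaves a single one behind.\<close>

lemma greedy_steps_exist:
  assumes "finite U" and "card U = 2 * k"
  shows "\<exists>G'. (greedy_step SNR idx)\<^sup>*\<^sup>* (U, G) ({}, G')"
  using assms
proof (induction k arbitrary: U G)
  case 0
  then show ?case
    by auto
next
  case (Suc k)
  then have "2 \<le> card U"
    by simp
  then obtain x y where "x \<in> U" "y \<in> U" "x \<noteq> y"
    by (auto simp: card_le_Suc_iff numeral_2_eq_2)
  then obtain a b where ab: "a \<in> U" "b \<in> U" "a \<noteq> b"
    and step: "greedy_step SNR idx (U, G) (U - {a, b}, insert {a, b} G)"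
    using greedy_step_exists[OF Suc.prems(1)] by metis
  have "card (U - {a, b}) = 2 * k"
    using ab Suc.prems by (simp add: card_Diff_subset)
  then obtain G' where "(greedy_step SNR idx)\<^sup>*\<^sup>* (U - {a, b}, insert {a, b} G) ({}, G')"
    using Suc.IH Suc.prems(1) by blast
  then show ?case
    using step by (blast intro: converse_rtranclp_into_rtranclp)
qed

theorem theorem1:
  fixes N m :: nat
    and SNR :: "nat \<Rightarrow> real"
    and n :: "nat \<Rightarrow> nat"
    and R :: "'r set"
    and idx :: "'r \<Rightarrow> nat"
  assumes "N \<ge> 1" and "m \<ge> 1"
    and "mono_on {1..m} SNR"
    and "(\<Sum>i=1..m. n i) = 2 * N"
    and "finite R" and "card R = 2 * N"
    and "\<And>r. r \<in> R \<Longrightarrow> idx r \<in> {1..m}"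
    and "\<And>i. i \<in> {1..m} \<Longrightarrow> card {r \<in> R. idx r = i} = n i"
  shows "(\<exists>G. greedy_output SNR idx R G) \<and>
    (\<forall>G. greedy_output SNR idx R G \<longrightarrow>
      grouping R N G \<and>
      (\<forall>H. grouping R N H \<longrightarrow> avg_diff SNR idx N H \<le> avg_diff SNR idx N G))"
proof (intro conjI allI impI)
  show "\<exists>G. greedy_output SNR idx R G"
    unfolding greedy_output_def using greedy_steps_exist assms(5,6) by blast
next
  fix G
  assume "greedy_output SNR idx R G"
  \<comment> \<open>A run starts with no pairs formed, so the set \<open>P\<close> of added pairs is
    the whole output \<open>G\<close>.\<close>
  then have G: "grouping R N G \<and>
    (\<forall>H. grouping R N H \<longrightarrow> sum (pair_diff SNR idx) H \<le> sum (pair_diff SNR idx) G)"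
    unfolding greedy_output_def using greedy_steps_optimal assms(5,6) by fastforce
  then show "grouping R N G"
    by blast
  show "avg_diff SNR idx N H \<le> avg_diff SNR idx N G" if "grouping R N H" for H
    unfolding avg_diff_def using G that by (intro mult_left_mono) auto
qed

end
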